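(* Let $g\in H^{\infty}$ be non-constant. Then the integral operator $S_g:\mathcal{B}_0\to\mathcal{B}_0$ does not attain its norm, i.e. there is no $f\in\mathcal{B}_0$ with $\|f\|_{\mathcal{B}}=1$ and $\|S_g f\|_{\mathcal{B}}=\|S_g\|$.
   Context: $\mathbb{D}$ is the open unit disc in $\mathbb{C}$, $H(\mathbb{D})$ is the space of analytic functions on $\mathbb{D}$, and $H^\infty$ is the set of bounded functions in $H(\mathbb{D})$. For $g\in H(\mathbb{D})$, the operator $S_g$ is defined on $H(\mathbb{D})$ by $S_gf(z)=\int_0^z f'(w)g(w)\,dw$. The Bloch space $\mathcal{B}$ is the Banach space of all $f\in H(\mathbb{D})$ with $\|f\|_{\mathcal{B}}=|f(0)|+\sup_{z\in\mathbb{D}}(1-|z|^2)|f'(z)|<\infty$. The little Bloch space $\mathcal{B}_0$ is the closed subspace of all $f\in\mathcal{B}$ with $\lim_{|z|\to1}(1-|z|^2)|f'(z)|=0$, with the norm $\|\cdot\|_{\mathcal{B}}$. It is known that $S_g$ is bounded on $\mathcal{B}$ (respectively on $\mathcal{B}_0$) if and only if $g\in H^\infty$. $\|S_g\|$ denotes the operator norm of $S_g$ on $\mathcal{B}_0$. *)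

theory Defs
  imports "HOL-Complex_Analysis.Complex_Analysis"
begin

text \<open>
  A function on the open unit disc is represented by a total function on the complex plane.
  Every notion below depends only on its values on the disc.
\<close>

abbreviation unit_disc :: "complex set" where
  "unit_disc \<equiv> ball 0 1"

definition H_infty :: "(complex \<Rightarrow> complex) set" where
  "H_infty = {g. g holomorphic_on unit_disc \<and> bounded (g ` unit_disc)}"

definition S_op :: "(complex \<Rightarrow> complex) \<Rightarrow> (complex \<Rightarrow> complex) \<Rightarrow> complex \<Rightarrow> complex" where
  "S_op g f z = contour_integral (linepath 0 z) (\<lambda>w. deriv f w * g w)"

definition bloch_norm :: "(complex \<Rightarrow> complex) \<Rightarrow> real" where
  "bloch_norm f = norm (f 0) + (SUP z\<in>unit_disc. (1 - (norm z)\<^sup>2) * norm (deriv f z))"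

text \<open>The finiteness of the norm is the boundedness condition; the real supremum in
  \<open>bloch_norm\<close> is meaningful only under it.\<close>

definition bloch :: "(complex \<Rightarrow> complex) set" where
  "bloch = {f. f holomorphic_on unit_disc \<and>
               bdd_above ((\<lambda>z. (1 - (norm z)\<^sup>2) * norm (deriv f z)) ` unit_disc)}"

text \<open>The filter \<open>filtercomap norm (at_left 1)\<close> describes \<open>norm z\<close> tending to 1 with
  \<open>z\<close> inside the disc, uniformly in the argument of \<open>z\<close>.\<close>

definition little_bloch :: "(complex \<Rightarrow> complex) set" where
  "little_bloch = {f \<in> bloch.
     ((\<lambda>z. (1 - (norm z)\<^sup>2) * norm (deriv f z)) \<longlongrightarrow> 0) (filtercomap norm (at_left 1))}"

definition little_bloch_opnorm ::
    "((complex \<Rightarrow> complex) \<Rightarrow> (complex \<Rightarrow> complex)) \<Rightarrow> real" where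
  "little_bloch_opnorm T = (SUP f\<in>{f \<in> little_bloch. bloch_norm f \<le> 1}. bloch_norm (T f))"

text \<open>For \<open>g\<close> in \<open>H_infty\<close> the operator maps \<open>little_bloch\<close> to itself, and the supremum
  defining its operator norm is taken over a nonempty set that is bounded above.\<close>

lemma S_op_has_field_derivative:
  assumes "g holomorphic_on unit_disc" "f holomorphic_on unit_disc" "z \<in> unit_disc"
  shows "(S_op g f has_field_derivative deriv f z * g z) (at z)"
proof -
  let ?h = "\<lambda>w. deriv f w * g w"
  have h: "?h holomorphic_on unit_disc"
    using assms by (intro holomorphic_intros) auto
  obtain F where F: "\<And>w. w \<in> unit_disc \<Longrightarrow> (F has_field_derivative ?h w) (at w within unit_disc)"
    using holomorphic_convex_primitive'[OF _ _ h] by auto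
  have eq: "S_op g f w = F w - F 0" if "w \<in> unit_disc" for w
  proof -
    have "closed_segment 0 w \<subseteq> unit_disc"
      using that by (intro closed_segment_subset) auto
    then have "(?h has_contour_integral (F (pathfinish (linepath 0 w)) - F (pathstart (linepath 0 w))))
                 (linepath 0 w)"
      by (intro contour_integral_primitive[where S = unit_disc] F)
         (simp_all only: valid_path_linepath path_image_linepath)
    then show ?thesis
      unfolding S_op_def pathfinish_linepath pathstart_linepath
      by (rule contour_integral_unique)
  qed
  have "(F has_field_derivative ?h z) (at z)"
    using F[OF assms(3)] by (simp only: at_within_open[OF assms(3) open_ball])
  then have "((\<lambda>w. F w - F 0) has_field_derivative ?h z - 0) (at z)"
    by (intro DERIV_diff DERIV_const)
  then have "((\<lambda>w. F w - F 0) has_field_derivative ?h z) (at z)"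
    by (simp only: diff_zero)
  then show ?thesis
    by (rule has_field_derivative_transform_within_open[OF _ open_ball assms(3)])
       (rule eq[symmetric])
qed

lemma S_op_bloch_bound:
  assumes "norm (g z) \<le> B" "g holomorphic_on unit_disc" "f holomorphic_on unit_disc" "z \<in> unit_disc"
  shows "(1 - (norm z)\<^sup>2) * norm (deriv (S_op g f) z) \<le> B * ((1 - (norm z)\<^sup>2) * norm (deriv f z))"
proof -
  have "deriv (S_op g f) z = deriv f z * g z"
    using S_op_has_field_derivative[OF assms(2-4)] by (rule DERIV_imp_deriv)
  moreover have "0 \<le> (1 - (norm z)\<^sup>2) * norm (deriv f z)"
    using assms(4) by (simp add: abs_square_le_1)
  ultimately show ?thesis
    using mult_right_mono[OF assms(1), of "(1 - (norm z)\<^sup>2) * norm (deriv f z)"]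
    by (simp add: norm_mult mult_ac)
qed

lemma S_op_little_bloch:
  assumes g: "g \<in> H_infty" and f: "f \<in> little_bloch"
  shows "S_op g f \<in> little_bloch"
proof -
  let ?b = "\<lambda>f z. (1 - (norm z)\<^sup>2) * norm (deriv f z) :: real"
  have hol: "g holomorphic_on unit_disc" "f holomorphic_on unit_disc"
    using g f by (auto simp: H_infty_def little_bloch_def bloch_def)
  obtain B where B: "0 < B" "\<And>z. z \<in> unit_disc \<Longrightarrow> norm (g z) \<le> B"
    using g by (auto simp: H_infty_def bounded_pos)
  note le = S_op_bloch_bound[OF B(2) hol]
  obtain M where M: "\<And>z. z \<in> unit_disc \<Longrightarrow> ?b f z \<le> M"
    using f unfolding little_bloch_def bloch_def bdd_above_def by blast
  have "S_op g f holomorphic_on unit_disc"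
    unfolding holomorphic_on_open[OF open_ball]
    by (intro ballI exI) (rule S_op_has_field_derivative[OF hol])
  moreover have "bdd_above (?b (S_op g f) ` unit_disc)"
  proof (rule bdd_aboveI2)
    fix z assume z: "z \<in> unit_disc"
    show "?b (S_op g f) z \<le> B * M"
      using le[OF z z] mult_left_mono[OF M[OF z], of B] B(1) by linarith
  qed
  moreover have "(?b (S_op g f) \<longlongrightarrow> 0) (filtercomap norm (at_left 1))"
  proof (rule tendsto_sandwich)
    have "eventually (\<lambda>x. x < (1::real)) (at_left 1)"
      by (simp add: eventually_at_filter)
    then have ev: "eventually (\<lambda>z::complex. z \<in> unit_disc) (filtercomap norm (at_left 1))"
      by (auto simp: eventually_filtercomap)
    show "eventually (\<lambda>z. ?b (S_op g f) z \<le> B * ?b f z) (filtercomap norm (at_left 1))"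
      using ev by eventually_elim (rule le)
    show "eventually (\<lambda>z. 0 \<le> ?b (S_op g f) z) (filtercomap norm (at_left 1))"
      using ev by eventually_elim (simp add: abs_square_le_1)
    have "(?b f \<longlongrightarrow> 0) (filtercomap norm (at_left 1))"
      using f by (simp add: little_bloch_def)
    then show "((\<lambda>z. B * ?b f z) \<longlongrightarrow> 0) (filtercomap norm (at_left 1))"
      by (rule tendsto_mult_right_zero)
  qed simp
  ultimately show ?thesis
    by (simp add: little_bloch_def bloch_def)
qed

lemma little_bloch_unit_ball_nonempty: "{f \<in> little_bloch. bloch_norm f \<le> 1} \<noteq> {}"
proof -
  have "(\<lambda>_. 0) \<in> {f \<in> little_bloch. bloch_norm f \<le> 1}"
    by (simp add: little_bloch_def bloch_def bloch_norm_def bdd_aboveI2[of _ _ 0])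
  then show ?thesis by blast
qed

lemma bdd_above_S_op:
  assumes g: "g \<in> H_infty"
  shows "bdd_above ((\<lambda>f. bloch_norm (S_op g f)) ` {f \<in> little_bloch. bloch_norm f \<le> 1})"
proof -
  let ?b = "\<lambda>f z. (1 - (norm z)\<^sup>2) * norm (deriv f z) :: real"
  obtain B where B: "0 < B" "\<And>z. z \<in> unit_disc \<Longrightarrow> norm (g z) \<le> B"
    using g by (auto simp: H_infty_def bounded_pos)
  show ?thesis
  proof (rule bdd_aboveI2)
    fix f assume f: "f \<in> {f \<in> little_bloch. bloch_norm f \<le> 1}"
    have hol: "g holomorphic_on unit_disc" "f holomorphic_on unit_disc"
      using g f by (auto simp: H_infty_def little_bloch_def bloch_def)
    have bdd: "bdd_above (?b f ` unit_disc)"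
      using f by (simp add: little_bloch_def bloch_def)
    have "(SUP z\<in>unit_disc. ?b (S_op g f) z) \<le> B"
    proof (rule cSUP_least)
      fix z assume z: "z \<in> unit_disc"
      have "?b f z \<le> (SUP z\<in>unit_disc. ?b f z)"
        by (rule cSUP_upper[OF z bdd])
      also have "\<dots> \<le> 1"
        using f norm_ge_zero[of "f 0"] unfolding bloch_norm_def mem_Collect_eq by linarith
      finally have "B * ?b f z \<le> B * 1"
        using B(1) by (intro mult_left_mono) auto
      then show "?b (S_op g f) z \<le> B"
        using S_op_bloch_bound[OF B(2)[OF z] hol z] by linarith
    qed simp
    then show "bloch_norm (S_op g f) \<le> B"
      by (simp add: bloch_norm_def S_op_def)
  qed
qed

end

theory Submission
  imports Defs
begin

text \<open>
  The disc automorphisms \<open>\<phi>\<^sub>a z = (z - a) / (1 - cnj a * z)\<close>, shifted so as to vanish at the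
  origin, have norm at most 1 in the little Bloch space, and their weighted derivative
  \<open>(1 - |z|\<^sup>2) |\<phi>\<^sub>a' z|\<close> equals 1 at \<open>z = a\<close>. Testing \<open>S_op g\<close> on them gives
  \<open>|g a| \<le> N\<close> for every \<open>a\<close> in the disc, where \<open>N\<close> is the operator norm
  (\<open>norm_le_little_bloch_opnorm\<close>).

  Suppose that the norm is attained at a unit vector \<open>f\<close>. Since \<open>S_op g f\<close> lies in the little
  Bloch space and vanishes at the origin, its norm is a maximum
  (\<open>little_bloch_weighted_deriv_attains_Sup\<close>):
  \<open>N = (1 - |z|\<^sup>2) |f' z| |g z|\<close> for some \<open>z\<close> in the disc, whence \<open>N \<le> |g z|\<close>. So \<open>|g|\<close> has an
  interior maximum at \<open>z\<close>, and \<open>g\<close> is constant by the maximum modulus principle.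
\<close>

lemma weighted_deriv_le_bloch_norm:
  assumes "f \<in> bloch" "z \<in> unit_disc"
  shows "(1 - (norm z)\<^sup>2) * norm (deriv f z) \<le> bloch_norm f"
proof -
  have "(1 - (norm z)\<^sup>2) * norm (deriv f z) \<le> (SUP z\<in>unit_disc. (1 - (norm z)\<^sup>2) * norm (deriv f z))"
    using assms by (intro cSUP_upper) (auto simp: bloch_def)
  then show ?thesis
    unfolding bloch_norm_def using norm_ge_zero[of "f 0"] by linarith
qed

lemma eventually_filtercomap_norm_at_left_1:
  "eventually P (filtercomap norm (at_left (1::real))) \<longleftrightarrow>
     (\<exists>r<1. \<forall>z::complex. r < norm z \<and> norm z < 1 \<longrightarrow> P z)"
proof -
  have "eventually P (filtercomap norm (at_left (1::real))) \<longleftrightarrow>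
        (\<exists>Q. (\<exists>b<1. \<forall>y>b. y < (1::real) \<longrightarrow> Q y) \<and> (\<forall>z::complex. Q (norm z) \<longrightarrow> P z))"
    by (simp add: eventually_filtercomap eventually_at_left[of 0 "1::real"])
  also have "\<dots> \<longleftrightarrow> (\<exists>r<1. \<forall>z::complex. r < norm z \<and> norm z < 1 \<longrightarrow> P z)"
    (is "?L \<longleftrightarrow> ?R")
  proof
    assume ?R
    then obtain r where "r < 1" "\<forall>z::complex. r < norm z \<and> norm z < 1 \<longrightarrow> P z"
      by blast
    then show ?L
      by (intro exI[of _ "\<lambda>y. r < y \<and> y < 1"]) auto
  qed blast
  finally show ?thesis .
qed

lemma bounded_deriv_imp_little_bloch:
  assumes hol: "f holomorphic_on unit_disc"
    and bound: "\<And>z. z \<in> unit_disc \<Longrightarrow> norm (deriv f z) \<le> C"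
  shows "f \<in> little_bloch"
proof -
  let ?b = "\<lambda>z. (1 - (norm z)\<^sup>2) * norm (deriv f z)"
  have nonneg: "0 \<le> 1 - (norm z)\<^sup>2" if "z \<in> unit_disc" for z :: complex
    using that by (simp add: abs_square_le_1)
  have le: "?b z \<le> (1 - (norm z)\<^sup>2) * C" if "z \<in> unit_disc" for z
    using nonneg[OF that] bound[OF that] by (rule mult_left_mono[rotated])
  have "bdd_above (?b ` unit_disc)"
  proof (rule bdd_aboveI2)
    fix z assume z: "z \<in> unit_disc"
    have "?b z \<le> 1 * norm (deriv f z)"
      by (intro mult_right_mono) auto
    then show "?b z \<le> C"
      using bound[OF z] by simp
  qed
  moreover have "(?b \<longlongrightarrow> 0) (filtercomap norm (at_left 1))"
  proof (rule tendsto_sandwich)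
    have ev: "eventually (\<lambda>z::complex. z \<in> unit_disc) (filtercomap norm (at_left 1))"
      unfolding eventually_filtercomap_norm_at_left_1 by (intro exI[of _ 0]) auto
    show "eventually (\<lambda>z. 0 \<le> ?b z) (filtercomap norm (at_left 1))"
      using ev by eventually_elim (simp add: abs_square_le_1)
    show "eventually (\<lambda>z. ?b z \<le> (1 - (norm z)\<^sup>2) * C) (filtercomap norm (at_left 1))"
      using ev by eventually_elim (rule le)
    have "((\<lambda>x. (1 - x\<^sup>2) * C) \<longlongrightarrow> (1 - 1\<^sup>2) * C) (at_left (1::real))"
      by (intro tendsto_intros)
    then have "((\<lambda>x. (1 - x\<^sup>2) * C) \<longlongrightarrow> 0) (at_left (1::real))"
      by simp
    then show "((\<lambda>z::complex. (1 - (norm z)\<^sup>2) * C) \<longlongrightarrow> 0) (filtercomap norm (at_left 1))"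
      by (rule filterlim_compose) (rule filterlim_filtercomap)
  qed simp
  ultimately show ?thesis
    using hol by (simp add: little_bloch_def bloch_def)
qed

lemma norm_one_minus_cnj_mult_squared:
  "(norm (1 - cnj a * z))\<^sup>2 = (1 - (norm z)\<^sup>2) * (1 - (norm a)\<^sup>2) + (norm (z - a))\<^sup>2"
  by (simp only: cmod_power2) (simp add: algebra_simps power2_eq_square)

text \<open>The extremal functions, primitives of \<open>(1 - |a|\<^sup>2) / (1 - cnj a * z)\<^sup>2\<close>.\<close>

lemma little_bloch_extremal:
  assumes a: "a \<in> unit_disc"
  obtains f where "f \<in> little_bloch" "bloch_norm f \<le> 1"
    "(1 - (norm a)\<^sup>2) * norm (deriv f a) = 1"
proof
  define f where "f z = (z - a) / (1 - cnj a * z) + a" for z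
  have na: "norm a < 1"
    using a by simp
  have pos: "0 < 1 - (norm a)\<^sup>2"
    using na by (simp add: abs_square_less_1)
  have low: "1 - norm a \<le> norm (1 - cnj a * z)" if "z \<in> unit_disc" for z
  proof -
    have "norm (cnj a * z) \<le> norm a * 1"
      unfolding norm_mult complex_mod_cnj using that by (intro mult_left_mono) auto
    then show ?thesis
      using norm_triangle_ineq2[of 1 "cnj a * z"] by simp
  qed
  have nz: "1 - cnj a * z \<noteq> 0" if "z \<in> unit_disc" for z
    using low[OF that] na by auto
  have der: "(f has_field_derivative of_real (1 - (norm a)\<^sup>2) / (1 - cnj a * z)\<^sup>2) (at z)"
    if "z \<in> unit_disc" for z
  proof -
    have num: "1 * (1 - cnj a * z) - (z - a) * (- cnj a) = of_real (1 - (norm a)\<^sup>2)"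
      using complex_norm_square[of a] by (simp add: algebra_simps)
    show ?thesis
      unfolding f_def num[symmetric] using nz[OF that]
      by (auto intro!: derivative_eq_intros simp: power2_eq_square)
  qed
  have nd: "norm (deriv f z) = (1 - (norm a)\<^sup>2) / (norm (1 - cnj a * z))\<^sup>2" if "z \<in> unit_disc" for z
    using DERIV_imp_deriv[OF der[OF that]] pos
    by (simp add: norm_divide norm_power del: of_real_diff of_real_power)
  show "f \<in> little_bloch"
  proof (rule bounded_deriv_imp_little_bloch)
    show "f holomorphic_on unit_disc"
      unfolding holomorphic_on_open[OF open_ball] using der by blast
    fix z assume z: "z \<in> unit_disc"
    show "norm (deriv f z) \<le> (1 - (norm a)\<^sup>2) / (1 - norm a)\<^sup>2"
      unfolding nd[OF z] using low[OF z] na pos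
      by (intro divide_left_mono power_mono mult_pos_pos zero_less_power) auto
  qed
  have "(SUP z\<in>unit_disc. (1 - (norm z)\<^sup>2) * norm (deriv f z)) \<le> 1"
  proof (rule cSUP_least)
    fix z assume z: "z \<in> unit_disc"
    have "(1 - (norm z)\<^sup>2) * (1 - (norm a)\<^sup>2) \<le> (norm (1 - cnj a * z))\<^sup>2"
      by (simp add: norm_one_minus_cnj_mult_squared)
    then show "(1 - (norm z)\<^sup>2) * norm (deriv f z) \<le> 1"
      using nz[OF z] unfolding nd[OF z] by (simp add: divide_le_eq)
  qed simp
  then show "bloch_norm f \<le> 1"
    by (simp add: bloch_norm_def f_def)
  show "(1 - (norm a)\<^sup>2) * norm (deriv f a) = 1"
    using pos norm_one_minus_cnj_mult_squared[of a a] unfolding nd[OF a] by simp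
qed

lemma norm_le_little_bloch_opnorm:
  assumes g: "g \<in> H_infty" and a: "a \<in> unit_disc"
  shows "norm (g a) \<le> little_bloch_opnorm (S_op g)"
proof -
  obtain f where f: "f \<in> little_bloch" "bloch_norm f \<le> 1"
    and eq1: "(1 - (norm a)\<^sup>2) * norm (deriv f a) = 1"
    using little_bloch_extremal[OF a] .
  have hol: "g holomorphic_on unit_disc" "f holomorphic_on unit_disc"
    using g f by (auto simp: H_infty_def little_bloch_def bloch_def)
  have "deriv (S_op g f) a = deriv f a * g a"
    using S_op_has_field_derivative[OF hol a] by (rule DERIV_imp_deriv)
  then have "norm (g a) = (1 - (norm a)\<^sup>2) * norm (deriv (S_op g f) a)"
    using eq1 by (simp add: norm_mult flip: mult.assoc)
  also have "\<dots> \<le> bloch_norm (S_op g f)"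
    using S_op_little_bloch[OF g f(1)] a
    by (intro weighted_deriv_le_bloch_norm) (auto simp: little_bloch_def)
  also have "\<dots> \<le> little_bloch_opnorm (S_op g)"
    unfolding little_bloch_opnorm_def
    using f by (intro cSUP_upper bdd_above_S_op[OF g]) auto
  finally show ?thesis .
qed

text \<open>The weighted derivative is continuous on the disc and vanishes at the boundary, so its
  supremum is a maximum.\<close>

lemma little_bloch_weighted_deriv_attains_Sup:
  assumes f: "f \<in> little_bloch"
    and pos: "0 < (SUP z\<in>unit_disc. (1 - (norm z)\<^sup>2) * norm (deriv f z))" (is "0 < ?N")
  obtains z where "z \<in> unit_disc"
    "(1 - (norm z)\<^sup>2) * norm (deriv f z) = (SUP z\<in>unit_disc. (1 - (norm z)\<^sup>2) * norm (deriv f z))"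
proof -
  let ?b = "\<lambda>z. (1 - (norm z)\<^sup>2) * norm (deriv f z)"
  have hol: "f holomorphic_on unit_disc" and bdd: "bdd_above (?b ` unit_disc)"
    and lim: "(?b \<longlongrightarrow> 0) (filtercomap norm (at_left 1))"
    using f by (auto simp: little_bloch_def bloch_def)
  have "eventually (\<lambda>z. ?b z < ?N / 2) (filtercomap norm (at_left 1))"
    using order_tendstoD(2)[OF lim, of "?N / 2"] pos by simp
  then obtain r where r: "r < 1" "\<And>z. r < norm z \<Longrightarrow> norm z < 1 \<Longrightarrow> ?b z < ?N / 2"
    unfolding eventually_filtercomap_norm_at_left_1 by blast
  \<comment> \<open>The radius \<open>r\<close> may be negative; its positive part makes the closed disc nonempty.\<close>
  let ?K = "cball (0::complex) (max r 0)"
  have K: "?K \<subseteq> unit_disc"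
    using r(1) by auto
  have "continuous_on unit_disc (deriv f)"
    using hol by (intro holomorphic_on_imp_continuous_on holomorphic_intros) auto
  then have "continuous_on ?K ?b"
    using K by (intro continuous_intros) (rule continuous_on_subset)
  then obtain z where z: "z \<in> ?K" "\<And>w. w \<in> ?K \<Longrightarrow> ?b w \<le> ?b z"
    using continuous_attains_sup[of ?K ?b] by auto
  have "?N \<le> max (?b z) (?N / 2)"
  proof (rule cSUP_least)
    fix w :: complex assume w: "w \<in> unit_disc"
    show "?b w \<le> max (?b z) (?N / 2)"
    proof (cases "w \<in> ?K")
      case True
      then show ?thesis using z(2)[of w] by (intro max.coboundedI1)
    next
      case False
      then have "?b w < ?N / 2" using w by (intro r(2)) auto
      then show ?thesis by (intro max.coboundedI2 less_imp_le)
    qed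
  qed simp
  then have "?N \<le> ?b z"
    using pos by linarith
  moreover have "?b z \<le> ?N"
    using z(1) K by (intro cSUP_upper bdd) auto
  ultimately show ?thesis
    using that[of z] z(1) K by auto
qed

theorem theorem1:
  fixes g :: "complex \<Rightarrow> complex"
  assumes "g \<in> H_infty"
    and "\<not> g constant_on unit_disc"
  shows "\<not> (\<exists>f\<in>little_bloch. bloch_norm f = 1 \<and> bloch_norm (S_op g f) = little_bloch_opnorm (S_op g))"
proof
  define N where "N = little_bloch_opnorm (S_op g)"
  assume "\<exists>f\<in>little_bloch. bloch_norm f = 1 \<and> bloch_norm (S_op g f) = little_bloch_opnorm (S_op g)"
  then obtain f where f: "f \<in> little_bloch" "bloch_norm f = 1" "bloch_norm (S_op g f) = N"
    unfolding N_def by blast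
  have hol: "g holomorphic_on unit_disc" "f holomorphic_on unit_disc"
    using assms(1) f(1) by (auto simp: H_infty_def little_bloch_def bloch_def)
  have gN: "norm (g a) \<le> N" if "a \<in> unit_disc" for a
    unfolding N_def using assms(1) that by (rule norm_le_little_bloch_opnorm)
  obtain a where a: "a \<in> unit_disc" "g a \<noteq> 0"
    using assms(2) unfolding constant_on_def by blast
  have pos: "0 < N"
    using gN[OF a(1)] a(2) by (meson less_le_trans zero_less_norm_iff)
  have NSup: "(SUP z\<in>unit_disc. (1 - (norm z)\<^sup>2) * norm (deriv (S_op g f) z)) = N"
    using f(3) by (simp add: bloch_norm_def S_op_def)
  obtain z where z: "z \<in> unit_disc" "(1 - (norm z)\<^sup>2) * norm (deriv (S_op g f) z) = N"
    using little_bloch_weighted_deriv_attains_Sup[OF S_op_little_bloch[OF assms(1) f(1)]] pos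
    unfolding NSup by blast
  have "N \<le> norm (g z) * ((1 - (norm z)\<^sup>2) * norm (deriv f z))"
    using S_op_bloch_bound[OF order_refl hol z(1)] z(2) by simp
  also have "\<dots> \<le> norm (g z) * 1"
    using weighted_deriv_le_bloch_norm[of f z] f z(1)
    by (intro mult_left_mono) (auto simp: little_bloch_def)
  finally have "norm (g w) \<le> norm (g z)" if "w \<in> unit_disc" for w
    using gN[OF that] by simp
  then have "g constant_on unit_disc"
    using z(1) by (intro maximum_modulus_principle[OF hol(1), of unit_disc z]) auto
  with assms(2) show False ..
qed

end
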